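(* Every finite locally unital MTL-chain is (isomorphic to) an ordinal sum of archimedean MTL-chains.
   Context: A semihoop is an algebra $(A,\cdot,\rightarrow,\wedge,\vee,1)$ such that $(A,\wedge,\vee)$ is a lattice with greatest element $1$, $(A,\cdot,1)$ is a commutative monoid, and for all $x,y,z\in A$: $xy\le z$ if and only if $x\le y\rightarrow z$, and $(x\rightarrow y)\vee(y\rightarrow x)=1$. An MTL-algebra is a semihoop with a least element $0$; an MTL-chain is a totally ordered MTL-algebra. An MTL-algebra is locally unital if it satisfies the quasi-identity: if $e^2=e$ and $e\vee x=e$, then $ex=x$. An MTL-chain is archimedean if for all $x\le y<1$ there is $n\in\mathbb{N}$ with $y^n\le x$. Ordinal sum: let $(I,\le)$ be a totally ordered set and $\{A_i\}_{i\in I}$ a family of totally ordered semihoops, whose units are identified and which are otherwise made disjoint, so $A_i\cap A_j=\{1\}$ for $i\ne j$. The ordinal sum $\bigoplus_{i\in I}A_i$ has universe $\bigcup_{i\in I}A_i$ and operations: $x\cdot y=x\cdot_i y$ if $x,y\in A_i$; $x\cdot y=y$ if $x\in A_i$, $y\in A_j-\{1\}$, $i>j$; $x\cdot y=x$ if $x\in A_i-\{1\}$, $y\in A_j$, $i<j$; and $x\rightarrow y=x\rightarrow_i y$ if $x,y\in A_i$; $x\rightarrow y=y$ if $x\in A_i$, $y\in A_j$, $i>j$; $x\rightarrow y=1$ if $x\in A_i-\{1\}$, $y\in A_j$, $i<j$. Its order is total, given by $x\le y$ iff $x\rightarrow y=1$ (it extends the order of each $A_i$, and elements of $A_i-\{1\}$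 lie below those of $A_j$ when $i<j$). *)

theory Defs
  imports "HOL-Algebra.Lattice" "HOL-Algebra.Group"
begin

record 'a semihoop = "'a monoid" +
  imp :: "['a, 'a] \<Rightarrow> 'a" (infixr \<open>\<leadsto>\<index>\<close> 60)
  wedge :: "['a, 'a] \<Rightarrow> 'a" (infixl \<open>\<curlywedge>\<index>\<close> 70)
  vee :: "['a, 'a] \<Rightarrow> 'a" (infixl \<open>\<curlyvee>\<index>\<close> 65)

text \<open>The order of the lattice reduct: \<open>x \<le> y\<close> iff \<open>x \<and> y = x\<close>.\<close>

definition lat_order :: "('a, 'm) semihoop_scheme \<Rightarrow> 'a gorder" where
  "lat_order A = \<lparr>carrier = carrier A, eq = (=), le = (\<lambda>x y. x \<curlywedge>\<^bsub>A\<^esub> y = x)\<rparr>"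

abbreviation sh_le :: "('a, 'm) semihoop_scheme \<Rightarrow> 'a \<Rightarrow> 'a \<Rightarrow> bool" where
  "sh_le A x y \<equiv> le (lat_order A) x y"

abbreviation sh_less :: "('a, 'm) semihoop_scheme \<Rightarrow> 'a \<Rightarrow> 'a \<Rightarrow> bool" where
  "sh_less A x y \<equiv> lless (lat_order A) x y"

text \<open>
  The axioms \<open>wedge_eq_meet\<close> and \<open>vee_eq_join\<close> say that the two lattice operations are the
  infimum and the supremum of the order they induce.
\<close>

locale semihoop = comm_monoid A + order: lattice "lat_order A" for A (structure) +
  assumes wedge_eq_meet:
      "\<lbrakk>x \<in> carrier A; y \<in> carrier A\<rbrakk> \<Longrightarrow> x \<curlywedge> y = x \<sqinter>\<^bsub>lat_order A\<^esub> y"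
    and vee_eq_join:
      "\<lbrakk>x \<in> carrier A; y \<in> carrier A\<rbrakk> \<Longrightarrow> x \<curlyvee> y = x \<squnion>\<^bsub>lat_order A\<^esub> y"
    and one_greatest: "greatest (lat_order A) \<one> (carrier A)"
    and imp_closed: "\<lbrakk>x \<in> carrier A; y \<in> carrier A\<rbrakk> \<Longrightarrow> x \<leadsto> y \<in> carrier A"
    and residuation:
      "\<lbrakk>x \<in> carrier A; y \<in> carrier A; z \<in> carrier A\<rbrakk>
        \<Longrightarrow> sh_le A (x \<otimes> y) z \<longleftrightarrow> sh_le A x (y \<leadsto> z)"
    and prelinearity:
      "\<lbrakk>x \<in> carrier A; y \<in> carrier A\<rbrakk> \<Longrightarrow> (x \<leadsto> y) \<curlyvee> (y \<leadsto> x) = \<one>"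

locale totally_ordered_semihoop = semihoop A + order: total_order "lat_order A" for A (structure)

locale mtl_algebra = semihoop A for A (structure) +
  assumes ex_zero: "\<exists>z. least (lat_order A) z (carrier A)"

locale mtl_chain = mtl_algebra A + totally_ordered_semihoop A for A (structure)

definition locally_unital :: "('a, 'm) semihoop_scheme \<Rightarrow> bool" where
  "locally_unital A \<longleftrightarrow>
    (\<forall>e \<in> carrier A. \<forall>x \<in> carrier A.
      e [^]\<^bsub>A\<^esub> (2::nat) = e \<and> e \<curlyvee>\<^bsub>A\<^esub> x = e \<longrightarrow> e \<otimes>\<^bsub>A\<^esub> x = x)"

definition archimedean :: "('a, 'm) semihoop_scheme \<Rightarrow> bool" where
  "archimedean A \<longleftrightarrow>
    (\<forall>x \<in> carrier A. \<forall>y \<in> carrier A.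
      sh_le A x y \<and> sh_less A y \<one>\<^bsub>A\<^esub> \<longrightarrow> (\<exists>n::nat. sh_le A (y [^]\<^bsub>A\<^esub> n) x))"

definition semihoop_iso ::
  "('a, 'm) semihoop_scheme \<Rightarrow> ('b, 'n) semihoop_scheme \<Rightarrow> ('a \<Rightarrow> 'b) set" where
  "semihoop_iso A B =
    {h \<in> iso A B. h \<one>\<^bsub>A\<^esub> = \<one>\<^bsub>B\<^esub> \<and>
      (\<forall>x \<in> carrier A. \<forall>y \<in> carrier A.
        h (x \<leadsto>\<^bsub>A\<^esub> y) = h x \<leadsto>\<^bsub>B\<^esub> h y \<and>
        h (x \<curlywedge>\<^bsub>A\<^esub> y) = h x \<curlywedge>\<^bsub>B\<^esub> h y \<and>
        h (x \<curlyvee>\<^bsub>A\<^esub> y) = h x \<curlyvee>\<^bsub>B\<^esub> h y)}"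

definition semihoop_isomorphic ::
  "('a, 'm) semihoop_scheme \<Rightarrow> ('b, 'n) semihoop_scheme \<Rightarrow> bool" where
  "semihoop_isomorphic A B \<longleftrightarrow> semihoop_iso A B \<noteq> {}"

text \<open>
  Ordinal sums. Making the components disjoint apart from a common unit is done by tagging:
  \<open>None\<close> is the common unit, and \<open>Some (i, x)\<close> is the element \<open>x \<noteq> 1\<close> of the component \<open>A i\<close>.
  The map \<open>osum_in A i\<close> embeds \<open>A i\<close>, and its image plays the role of \<open>A i\<close> inside the sum.
  The operations below give the usual case distinction, see \<open>osum_mult_same\<close> to \<open>osum_imp_less\<close>.
\<close>

definition osum_in :: "('i \<Rightarrow> 'a semihoop) \<Rightarrow> 'i \<Rightarrow> 'a \<Rightarrow> ('i \<times> 'a) option" where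
  "osum_in A i x = (if x = \<one>\<^bsub>A i\<^esub> then None else Some (i, x))"

fun osum_mult ::
  "('i::linorder \<Rightarrow> 'a semihoop) \<Rightarrow> ('i \<times> 'a) option \<Rightarrow> ('i \<times> 'a) option \<Rightarrow> ('i \<times> 'a) option"
where
  "osum_mult A None v = v"
| "osum_mult A u None = u"
| "osum_mult A (Some (i, x)) (Some (j, y)) =
    (if i = j then osum_in A i (x \<otimes>\<^bsub>A i\<^esub> y)
     else if i < j then Some (i, x)
     else Some (j, y))"

fun osum_imp ::
  "('i::linorder \<Rightarrow> 'a semihoop) \<Rightarrow> ('i \<times> 'a) option \<Rightarrow> ('i \<times> 'a) option \<Rightarrow> ('i \<times> 'a) option"
where
  "osum_imp A None v = v"
| "osum_imp A u None = None"
| "osum_imp A (Some (i, x)) (Some (j, y)) =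
    (if i = j then osum_in A i (x \<leadsto>\<^bsub>A i\<^esub> y)
     else if i < j then None
     else Some (j, y))"

text \<open>The lattice operations are minimum and maximum for the order \<open>u \<le> v\<close> iff \<open>u \<rightarrow> v = 1\<close>.\<close>

definition ordinal_sum ::
  "'i::linorder set \<Rightarrow> ('i \<Rightarrow> 'a semihoop) \<Rightarrow> (('i \<times> 'a) option) semihoop" where
  "ordinal_sum I A =
    \<lparr>carrier = (\<Union>i\<in>I. osum_in A i ` carrier (A i)),
     monoid.mult = osum_mult A,
     one = None,
     imp = osum_imp A,
     wedge = (\<lambda>u v. if osum_imp A u v = None then u else v),
     vee = (\<lambda>u v. if osum_imp A u v = None then v else u)\<rparr>"

lemma (in semihoop) one_imp: "x \<in> carrier A \<Longrightarrow> \<one> \<leadsto> x = x"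
proof -
  assume x: "x \<in> carrier A"
  have c: "carrier (lat_order A) = carrier A" by (simp add: lat_order_def)
  have i: "\<one> \<leadsto> x \<in> carrier A" using x imp_closed by simp
  have "sh_le A x (\<one> \<leadsto> x)" using residuation[of x \<one> x] x order.le_refl[of x] c by simp
  moreover have "sh_le A (\<one> \<leadsto> x) x"
    using residuation[of "\<one> \<leadsto> x" \<one> x] i x order.le_refl[of "\<one> \<leadsto> x"] c by simp
  ultimately show ?thesis using order.le_antisym x i c by metis
qed

lemma (in semihoop) imp_one: "x \<in> carrier A \<Longrightarrow> x \<leadsto> \<one> = \<one>"
proof -
  assume x: "x \<in> carrier A"
  have c: "carrier (lat_order A) = carrier A" by (simp add: lat_order_def)
  have i: "x \<leadsto> \<one> \<in> carrier A" using x imp_closed by simp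
  have "sh_le A \<one> (x \<leadsto> \<one>)"
    using residuation[of \<one> x \<one>] x one_greatest by (simp add: greatest_def)
  moreover have "sh_le A (x \<leadsto> \<one>) \<one>" using one_greatest i by (simp add: greatest_def)
  ultimately show ?thesis using order.le_antisym i one_closed c by metis
qed

lemma osum_in_eq_iff:
  "osum_in A i x = osum_in A j y \<longleftrightarrow>
    (x = \<one>\<^bsub>A i\<^esub> \<and> y = \<one>\<^bsub>A j\<^esub>) \<or> (i = j \<and> x = y)"
  by (auto simp: osum_in_def)

lemma osum_mult_same:
  assumes "semihoop (A i)" "x \<in> carrier (A i)" "y \<in> carrier (A i)"
  shows "osum_in A i x \<otimes>\<^bsub>ordinal_sum I A\<^esub> osum_in A i y = osum_in A i (x \<otimes>\<^bsub>A i\<^esub> y)"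
proof -
  interpret semihoop "A i" by fact
  show ?thesis using assms(2,3) by (simp add: osum_in_def ordinal_sum_def)
qed

lemma osum_mult_greater:
  assumes "j < i" "y \<noteq> \<one>\<^bsub>A j\<^esub>"
  shows "osum_in A i x \<otimes>\<^bsub>ordinal_sum I A\<^esub> osum_in A j y = osum_in A j y"
  using assms by (auto simp: osum_in_def ordinal_sum_def)

lemma osum_mult_less:
  assumes "i < j" "x \<noteq> \<one>\<^bsub>A i\<^esub>"
  shows "osum_in A i x \<otimes>\<^bsub>ordinal_sum I A\<^esub> osum_in A j y = osum_in A i x"
  using assms by (auto simp: osum_in_def ordinal_sum_def)

lemma osum_imp_same:
  assumes "semihoop (A i)" "x \<in> carrier (A i)" "y \<in> carrier (A i)"
  shows "osum_in A i x \<leadsto>\<^bsub>ordinal_sum I A\<^esub> osum_in A i y = osum_in A i (x \<leadsto>\<^bsub>A i\<^esub> y)"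
proof -
  interpret semihoop "A i" by fact
  show ?thesis using assms(2,3) by (simp add: osum_in_def ordinal_sum_def one_imp imp_one)
qed

lemma osum_imp_greater:
  assumes "j < i"
  shows "osum_in A i x \<leadsto>\<^bsub>ordinal_sum I A\<^esub> osum_in A j y = osum_in A j y"
  using assms by (auto simp: osum_in_def ordinal_sum_def)

lemma osum_imp_less:
  assumes "i < j" "x \<noteq> \<one>\<^bsub>A i\<^esub>"
  shows "osum_in A i x \<leadsto>\<^bsub>ordinal_sum I A\<^esub> osum_in A j y = \<one>\<^bsub>ordinal_sum I A\<^esub>"
  using assms by (auto simp: osum_in_def ordinal_sum_def)

lemma osum_le_iff:
  assumes "\<And>i. i \<in> I \<Longrightarrow> semihoop (A i)" "u \<in> carrier (ordinal_sum I A)"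
  shows "sh_le (ordinal_sum I A) u v \<longleftrightarrow> u \<leadsto>\<^bsub>ordinal_sum I A\<^esub> v = \<one>\<^bsub>ordinal_sum I A\<^esub>"
proof -
  have "osum_imp A u u = None"
  proof -
    obtain i x where i: "i \<in> I" "x \<in> carrier (A i)" "u = osum_in A i x"
      using assms(2) by (auto simp: ordinal_sum_def)
    interpret semihoop "A i" using assms(1) i(1) .
    have c: "carrier (lat_order (A i)) = carrier (A i)" by (simp add: lat_order_def)
    have "sh_le (A i) \<one>\<^bsub>A i\<^esub> (x \<leadsto>\<^bsub>A i\<^esub> x)"
      using residuation[of "\<one>\<^bsub>A i\<^esub>" x x] i(2) order.le_refl[of x] c by simp
    moreover have "sh_le (A i) (x \<leadsto>\<^bsub>A i\<^esub> x) \<one>\<^bsub>A i\<^esub>"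
      using one_greatest imp_closed i(2) by (simp add: greatest_def)
    ultimately have "x \<leadsto>\<^bsub>A i\<^esub> x = \<one>\<^bsub>A i\<^esub>"
      using order.le_antisym imp_closed[OF i(2) i(2)] one_closed c by metis
    then show ?thesis using i(3) by (simp add: osum_in_def)
  qed
  then show ?thesis by (auto simp: lat_order_def ordinal_sum_def)
qed

end

theory Submission
  imports Defs
begin

text \<open>
  Send \<open>x\<close> to the number of idempotents below it. In a locally unital chain an idempotent \<open>f\<close>
  separating \<open>x\<close> from \<open>y\<close>, \<open>x < f \<le> y\<close>, acts as a unit on \<open>x\<close>; hence
  \<open>x y = x\<close> and \<open>y \<rightarrow> x = x\<close>, as in an ordinal sum, and the level sets (with \<open>1\<close> added) are
  closed under the operations. By finiteness every \<open>y\<close> has an idempotent power \<open>y\<^sup>n \<le> y\<close>, and this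
  power lies below every element of the same level; so the level sets are archimedean.
\<close>

section \<open>Total orders: meets, joins and least elements of finite sets\<close>

lemma carrier_lat_order [simp]: "carrier (lat_order A) = carrier A"
  by (simp add: lat_order_def)

text \<open>The order is read off from \<open>wedge\<close> alone, so a subset taken as new carrier
  inherits it unchanged.\<close>

lemma sh_le_carrier_update [simp]: "sh_le (A\<lparr>carrier := S\<rparr>) = sh_le A"
  by (simp add: lat_order_def)

lemma sh_less_iff: "sh_less A x y \<longleftrightarrow> sh_le A x y \<and> x \<noteq> y"
  by (simp add: lless_def lat_order_def)

lemma (in total_order) meet_eq_if:
  assumes "x \<in> carrier L" "y \<in> carrier L"
  shows "x \<sqinter> y = (if x \<sqsubseteq> y then x else y)"
  by (metis assms le_antisym meet_left meet_right meet_closed meet_le le_refl total_order_total)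

lemma (in total_order) join_eq_if:
  assumes "x \<in> carrier L" "y \<in> carrier L"
  shows "x \<squnion> y = (if x \<sqsubseteq> y then y else x)"
  by (metis assms le_antisym join_left join_right join_closed join_le le_refl total_order_total)

lemma (in total_order) finite_has_least:
  assumes "finite S" "S \<noteq> {}" "S \<subseteq> carrier L"
  shows "\<exists>z. least L z S"
  using assms
proof (induction S rule: finite_ne_induct)
  case (singleton x)
  then show ?case by (auto simp: least_def)
next
  case (insert x S)
  then obtain z where z: "z \<in> S" "\<forall>y\<in>S. z \<sqsubseteq> y" by (auto simp: least_def)
  have c: "x \<in> carrier L" "z \<in> carrier L" "S \<subseteq> carrier L" using insert.prems z by auto
  show ?case
  proof (cases "x \<sqsubseteq> z")
    case True
    then have "least L x (insert x S)"
      using z c by (auto simp: least_def intro: le_trans)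
    then show ?thesis ..
  next
    case False
    then have "least L z (insert x S)"
      using z c total_order_total[of x z] by (auto simp: least_def)
    then show ?thesis ..
  qed
qed

section \<open>Residuation in a totally ordered semihoop\<close>

context totally_ordered_semihoop
begin

lemma sh_le_refl [simp]: "x \<in> carrier A \<Longrightarrow> sh_le A x x"
  using order.le_refl by simp

lemma sh_le_antisym:
  "\<lbrakk>sh_le A x y; sh_le A y x; x \<in> carrier A; y \<in> carrier A\<rbrakk> \<Longrightarrow> x = y"
  using order.le_antisym by simp

lemma sh_le_trans:
  "\<lbrakk>sh_le A x y; sh_le A y z; x \<in> carrier A; y \<in> carrier A; z \<in> carrier A\<rbrakk> \<Longrightarrow> sh_le A x z"
  using order.le_trans[of x y z] by simp

lemma sh_le_total: "\<lbrakk>x \<in> carrier A; y \<in> carrier A\<rbrakk> \<Longrightarrow> sh_le A x y \<or> sh_le A y x"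
  using order.total_order_total by simp

lemma sh_le_one [simp]: "x \<in> carrier A \<Longrightarrow> sh_le A x \<one>"
  using one_greatest by (simp add: greatest_def)

lemma wedge_eq_if:
  "\<lbrakk>x \<in> carrier A; y \<in> carrier A\<rbrakk> \<Longrightarrow> x \<curlywedge> y = (if sh_le A x y then x else y)"
  by (simp add: wedge_eq_meet order.meet_eq_if)

lemma vee_eq_if:
  "\<lbrakk>x \<in> carrier A; y \<in> carrier A\<rbrakk> \<Longrightarrow> x \<curlyvee> y = (if sh_le A x y then y else x)"
  by (simp add: vee_eq_join order.join_eq_if)

lemma imp_eq_one_iff:
  "\<lbrakk>x \<in> carrier A; y \<in> carrier A\<rbrakk> \<Longrightarrow> x \<leadsto> y = \<one> \<longleftrightarrow> sh_le A x y"
  by (metis residuation[of \<one> x y] imp_closed l_one one_closed sh_le_antisym sh_le_one sh_le_refl)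

text \<open>Monotonicity in the left factor comes from
  \<open>a' \<le> b \<leadsto> a' \<otimes> b\<close>, an instance of residuation; the right factor
  follows by commutativity.\<close>

lemma mult_mono:
  assumes "sh_le A x x'" "sh_le A y y'"
    and c: "x \<in> carrier A" "x' \<in> carrier A" "y \<in> carrier A" "y' \<in> carrier A"
  shows "sh_le A (x \<otimes> y) (x' \<otimes> y')"
proof -
  have mono_left: "sh_le A (a \<otimes> b) (a' \<otimes> b)"
    if "sh_le A a a'" "a \<in> carrier A" "a' \<in> carrier A" "b \<in> carrier A" for a a' b
  proof -
    have "sh_le A a' (b \<leadsto> a' \<otimes> b)"
      using that residuation[of a' b "a' \<otimes> b"] by simp
    then have "sh_le A a (b \<leadsto> a' \<otimes> b)"
      using that imp_closed sh_le_trans by blast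
    then show ?thesis using that residuation by simp
  qed
  have "sh_le A (x \<otimes> y) (x' \<otimes> y)" using assms mono_left by simp
  moreover have "sh_le A (x' \<otimes> y) (x' \<otimes> y')"
    using assms mono_left[of y y' x'] by (simp add: m_comm)
  ultimately show ?thesis using c sh_le_trans[of "x \<otimes> y" "x' \<otimes> y" "x' \<otimes> y'"] by simp
qed

lemma mult_le_left: "\<lbrakk>x \<in> carrier A; y \<in> carrier A\<rbrakk> \<Longrightarrow> sh_le A (x \<otimes> y) x"
  using mult_mono[of x x y \<one>] by simp

lemma le_imp: "\<lbrakk>x \<in> carrier A; y \<in> carrier A\<rbrakk> \<Longrightarrow> sh_le A y (x \<leadsto> y)"
  using residuation[of y x y] mult_le_left by simp

lemma imp_mult_le: "\<lbrakk>x \<in> carrier A; y \<in> carrier A\<rbrakk> \<Longrightarrow> sh_le A ((x \<leadsto> y) \<otimes> x) y"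
  using residuation[of "x \<leadsto> y" x y] imp_closed by simp

text \<open>Closure under the lattice operations is automatic: in a chain they are minimum and
  maximum.\<close>

lemma totally_ordered_semihoop_restrict:
  assumes S: "S \<subseteq> carrier A" "\<one> \<in> S"
    and mult: "\<And>x y. \<lbrakk>x \<in> S; y \<in> S\<rbrakk> \<Longrightarrow> x \<otimes> y \<in> S"
    and imp: "\<And>x y. \<lbrakk>x \<in> S; y \<in> S\<rbrakk> \<Longrightarrow> x \<leadsto> y \<in> S"
  shows "totally_ordered_semihoop (A\<lparr>carrier := S\<rparr>)"
proof -
  let ?B = "A\<lparr>carrier := S\<rparr>"
  have c: "x \<in> carrier A" if "x \<in> S" for x using S that by blast
  have eq: "eq (lat_order ?B) = (=)" by (simp add: lat_order_def)
  interpret B: total_order "lat_order ?B"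
    by unfold_locales
      (use c sh_le_total in \<open>auto simp: eq intro: sh_le_antisym sh_le_trans\<close>)
  interpret BM: comm_monoid ?B
    by (rule comm_monoidI) (auto simp: S mult c m_assoc intro: m_comm)
  show ?thesis
  proof unfold_locales
    fix x y assume xy: "x \<in> carrier ?B" "y \<in> carrier ?B"
    show "x \<curlywedge>\<^bsub>?B\<^esub> y = x \<sqinter>\<^bsub>lat_order ?B\<^esub> y"
      using xy by (simp add: B.meet_eq_if wedge_eq_if c)
    show "x \<curlyvee>\<^bsub>?B\<^esub> y = x \<squnion>\<^bsub>lat_order ?B\<^esub> y"
      using xy by (simp add: B.join_eq_if vee_eq_if c)
    show "x \<leadsto>\<^bsub>?B\<^esub> y \<in> carrier ?B" using xy imp by simp
    show "(x \<leadsto>\<^bsub>?B\<^esub> y) \<curlyvee>\<^bsub>?B\<^esub> (y \<leadsto>\<^bsub>?B\<^esub> x) = \<one>\<^bsub>?B\<^esub>"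
      using xy by (simp add: prelinearity c)
  next
    show "greatest (lat_order ?B) \<one>\<^bsub>?B\<^esub> (carrier ?B)"
      using S by (auto simp: greatest_def c)
  next
    fix x y z assume "x \<in> carrier ?B" "y \<in> carrier ?B" "z \<in> carrier ?B"
    then show "sh_le ?B (x \<otimes>\<^bsub>?B\<^esub> y) z \<longleftrightarrow> sh_le ?B x (y \<leadsto>\<^bsub>?B\<^esub> z)"
      by (simp add: residuation c)
  qed
qed

text \<open>The finitely many powers of \<open>y\<close> have a least one, \<open>y [^] n\<close>.
  Its square is again a power, so \<open>y [^] n\<close> is below its square, which in turn is below
  \<open>y [^] n\<close>.\<close>

lemma ex_idempotent_power:
  assumes fin: "finite (carrier A)" and y: "y \<in> carrier A"
  shows "\<exists>n::nat. y [^] n \<otimes> y [^] n = y [^] n \<and> sh_le A (y [^] n) y"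
proof -
  have "\<exists>z. least (lat_order A) z (range (\<lambda>n::nat. y [^] n))"
    using y by (intro order.finite_has_least) (auto intro: finite_subset[OF _ fin])
  then obtain n :: nat where n: "\<And>m::nat. sh_le A (y [^] n) (y [^] m)"
    by (auto simp: least_def)
  have "y [^] n \<otimes> y [^] n = y [^] n"
    using n[of "n + n"] y mult_le_left[of "y [^] n" "y [^] n"]
    by (intro sh_le_antisym) (auto simp: nat_pow_mult)
  moreover have "sh_le A (y [^] n) y" using n[of 1] y by simp
  ultimately show ?thesis by blast
qed

end

lemma (in totally_ordered_semihoop) mtl_chain_of_finite:
  assumes "finite (carrier A)"
  shows "mtl_chain A"
proof -
  have "\<exists>z. least (lat_order A) z (carrier A)"
    using assms one_closed by (intro order.finite_has_least) auto
  then show ?thesis by unfold_locales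
qed

section \<open>Idempotents below an element, and the levels they define\<close>

definition idem_below :: "('a, 'm) semihoop_scheme \<Rightarrow> 'a \<Rightarrow> 'a set" where
  "idem_below A x = {e \<in> carrier A. e \<otimes>\<^bsub>A\<^esub> e = e \<and> sh_le A e x}"

definition level :: "('a, 'm) semihoop_scheme \<Rightarrow> 'a \<Rightarrow> nat" where
  "level A x = card (idem_below A x)"

text \<open>The unit is added to every level because \<open>x \<leadsto> y\<close> is
  \<open>1\<close> whenever \<open>x \<le> y\<close>. In a finite chain the level of
  \<open>1\<close> contains nothing else, as \<open>1\<close> is itself idempotent, so it gives a
  trivial component.\<close>

definition level_part :: "('a, 'm) semihoop_scheme \<Rightarrow> nat \<Rightarrow> ('a, 'm) semihoop_scheme" where
  "level_part A i = A\<lparr>carrier := insert \<one>\<^bsub>A\<^esub> {x \<in> carrier A. level A x = i}\<rparr>"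

locale finite_locally_unital_chain = totally_ordered_semihoop A for A :: "'a semihoop" (structure) +
  assumes finite_carrier: "finite (carrier A)"
    and locally_unital: "locally_unital A"
begin

text \<open>Local unitality in terms of the order: in a chain, \<open>x \<le> e\<close> amounts to
  \<open>e \<curlyvee> x = e\<close>.\<close>

lemma idem_absorbs:
  assumes "e \<in> carrier A" "e \<otimes> e = e" "x \<in> carrier A" "sh_le A x e"
  shows "e \<otimes> x = x"
proof -
  have "e \<curlyvee> x = e" using assms sh_le_antisym by (auto simp: vee_eq_if)
  then show ?thesis
    using assms locally_unital by (simp add: locally_unital_def numeral_2_eq_2)
qed

lemma finite_idem_below: "finite (idem_below A x)"
  using finite_carrier by (simp add: idem_below_def)

lemma idem_below_mono:
  "\<lbrakk>x \<in> carrier A; y \<in> carrier A; sh_le A x y\<rbrakk> \<Longrightarrow> idem_below A x \<subseteq> idem_below A y"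
  by (auto simp: idem_below_def intro: sh_le_trans)

lemma level_mono:
  "\<lbrakk>x \<in> carrier A; y \<in> carrier A; sh_le A x y\<rbrakk> \<Longrightarrow> level A x \<le> level A y"
  by (simp add: level_def card_mono finite_idem_below idem_below_mono)

text \<open>In a chain the sets \<open>idem_below A x\<close> are nested, and nested finite sets of
  equal size coincide. Hence a number suffices as index of a level.\<close>

lemma idem_below_eq:
  assumes "x \<in> carrier A" "y \<in> carrier A" "level A x = level A y"
  shows "idem_below A x = idem_below A y"
  using assms sh_le_total[of x y] idem_below_mono finite_idem_below
  by (metis card_subset_eq level_def)

lemma ex_separating_idem:
  assumes "x \<in> carrier A" "y \<in> carrier A" "level A x < level A y"
  obtains f where "f \<in> carrier A" "f \<otimes> f = f" "sh_le A f y" "\<not> sh_le A f x" "sh_le A x f"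
proof -
  have "\<not> idem_below A y \<subseteq> idem_below A x"
    using assms(3) card_mono[OF finite_idem_below] by (auto simp: level_def not_le[symmetric])
  then obtain f where "f \<in> carrier A" "f \<otimes> f = f" "sh_le A f y" "\<not> sh_le A f x"
    by (auto simp: idem_below_def)
  then show thesis using that[of f] assms(1) sh_le_total[of x f] by simp
qed

lemma level_less_imp_le:
  "\<lbrakk>x \<in> carrier A; y \<in> carrier A; level A x < level A y\<rbrakk> \<Longrightarrow> sh_le A x y"
  using level_mono sh_le_total by (meson not_le)

section \<open>Operations between different levels and within one level\<close>

lemma mult_level_less:
  assumes c: "x \<in> carrier A" "y \<in> carrier A" and l: "level A x < level A y"
  shows "x \<otimes> y = x"
proof -
  obtain f where f: "f \<in> carrier A" "f \<otimes> f = f" "sh_le A f y" "sh_le A x f"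
    using ex_separating_idem[OF c l] by metis
  \<comment> \<open>The separating idempotent squeezes the product:
    \<open>x = x \<otimes> f \<le> x \<otimes> y \<le> x\<close>.\<close>
  have "sh_le A (x \<otimes> f) (x \<otimes> y)" using f c by (intro mult_mono) auto
  then have "sh_le A x (x \<otimes> y)" using f c idem_absorbs by (simp add: m_comm)
  then show ?thesis using c mult_le_left by (intro sh_le_antisym) auto
qed

lemma imp_level_less:
  assumes c: "x \<in> carrier A" "y \<in> carrier A" and l: "level A x < level A y"
  shows "y \<leadsto> x = x"
proof -
  obtain f where f: "f \<in> carrier A" "f \<otimes> f = f" "sh_le A f y" "\<not> sh_le A f x" "sh_le A x f"
    using ex_separating_idem[OF c l] .
  define z where "z = y \<leadsto> x"
  have z: "z \<in> carrier A" "sh_le A (z \<otimes> y) x"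
    using c imp_closed imp_mult_le by (auto simp: z_def)
  have "sh_le A (z \<otimes> f) (z \<otimes> y)" using f c z by (intro mult_mono) auto
  then have zf: "sh_le A (z \<otimes> f) x" using z c f sh_le_trans[of "z \<otimes> f" "z \<otimes> y" x] by simp
  \<comment> \<open>Otherwise \<open>f = f \<otimes> f \<le> z \<otimes> f \<le> x\<close>, against
    the choice of \<open>f\<close>. By totality \<open>z \<le> f\<close>, so \<open>f\<close>
    absorbs \<open>z\<close> as well and \<open>z = z \<otimes> f \<le> x\<close>.\<close>
  have "\<not> sh_le A f z"
  proof
    assume "sh_le A f z"
    then have "sh_le A (f \<otimes> f) (z \<otimes> f)" using f z by (intro mult_mono) auto
    then show False using f zf z c sh_le_trans[of f "z \<otimes> f" x] by simp
  qed
  then have "z \<otimes> f = z" using f z sh_le_total idem_absorbs by (metis m_comm)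
  then have "sh_le A z x" using zf by simp
  then show ?thesis using z c le_imp by (auto simp: z_def intro: sh_le_antisym)
qed

text \<open>An idempotent \<open>e\<close> below both factors is below the product, since
  \<open>e = e \<otimes> e\<close>; conversely the product is below \<open>x\<close>.\<close>

lemma level_mult:
  assumes c: "x \<in> carrier A" "y \<in> carrier A" and l: "level A x = level A y"
  shows "level A (x \<otimes> y) = level A x"
proof -
  have "sh_le A e (x \<otimes> y)" if e: "e \<in> idem_below A x" for e
  proof -
    have "e \<in> idem_below A y" using e idem_below_eq[OF c l] by simp
    then have "sh_le A (e \<otimes> e) (x \<otimes> y)"
      using e c by (intro mult_mono) (auto simp: idem_below_def)
    then show ?thesis using e by (simp add: idem_below_def)
  qed
  then have "idem_below A x \<subseteq> idem_below A (x \<otimes> y)" by (auto simp: idem_below_def)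
  then have "idem_below A (x \<otimes> y) = idem_below A x"
    using idem_below_mono[of "x \<otimes> y" x] c mult_le_left by auto
  then show ?thesis by (simp add: level_def)
qed

text \<open>If an idempotent \<open>e \<le> x \<leadsto> y\<close> were not below \<open>x\<close>,
  it would absorb \<open>x\<close>, and residuation would give
  \<open>x = e \<otimes> x \<le> y\<close>. Conversely \<open>y \<le> x \<leadsto> y\<close>, and
  \<open>y\<close> has the same idempotents below it as \<open>x\<close>.\<close>

lemma level_imp:
  assumes c: "x \<in> carrier A" "y \<in> carrier A" and l: "level A x = level A y"
    and n: "\<not> sh_le A x y"
  shows "level A (x \<leadsto> y) = level A x"
proof -
  have i: "x \<leadsto> y \<in> carrier A" using c imp_closed by simp
  have "e \<in> idem_below A x" if e: "e \<in> idem_below A (x \<leadsto> y)" for e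
  proof (rule ccontr)
    assume "e \<notin> idem_below A x"
    then have ex: "e \<otimes> x = x"
      using e c sh_le_total[of e x] idem_absorbs[of e x] by (auto simp: idem_below_def)
    have "sh_le A (e \<otimes> x) y" using e c residuation by (simp add: idem_below_def)
    then show False using ex n by simp
  qed
  moreover have "idem_below A x \<subseteq> idem_below A (x \<leadsto> y)"
    using idem_below_eq[OF c l] idem_below_mono[of y "x \<leadsto> y"] i c le_imp by simp
  ultimately have "idem_below A (x \<leadsto> y) = idem_below A x" by blast
  then show ?thesis by (simp add: level_def)
qed

section \<open>The levels as archimedean MTL-chains\<close>

lemma totally_ordered_semihoop_level_part: "totally_ordered_semihoop (level_part A i)"
  unfolding level_part_def
proof (rule totally_ordered_semihoop_restrict)
  let ?S = "insert \<one> {x \<in> carrier A. level A x = i}"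
  fix x y
  assume xy: "x \<in> ?S" "y \<in> ?S"
  then have c: "x \<in> carrier A" "y \<in> carrier A" by auto
  consider "x = \<one>" | "y = \<one>" | "level A x = i" "level A y = i" using xy by blast
  then show "x \<otimes> y \<in> ?S"
    by cases (use xy c level_mult in auto)
  \<comment> \<open>The case \<open>y = 1\<close> is covered by \<open>sh_le A x y\<close>.\<close>
  consider "x = \<one>" | "sh_le A x y" | "level A x = i" "level A y = i" "\<not> sh_le A x y"
    using xy c by auto
  then show "x \<leadsto> y \<in> ?S"
  proof cases
    case 1
    then show ?thesis using xy c by (simp add: one_imp)
  next
    case 2
    then have "x \<leadsto> y = \<one>" using c imp_eq_one_iff by simp
    then show ?thesis by simp
  next
    case 3
    then show ?thesis using c level_imp imp_closed by simp
  qed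
qed auto

lemma mtl_chain_level_part: "mtl_chain (level_part A i)"
proof -
  interpret P: totally_ordered_semihoop "level_part A i"
    by (rule totally_ordered_semihoop_level_part)
  show ?thesis
    using finite_carrier by (intro P.mtl_chain_of_finite) (simp add: level_part_def)
qed

lemma archimedean_level_part: "archimedean (level_part A i)"
  unfolding archimedean_def
proof (intro ballI impI, elim conjE)
  fix x y
  let ?B = "level_part A i"
  assume x: "x \<in> carrier ?B" and y: "y \<in> carrier ?B"
    and xy: "sh_le ?B x y" "sh_less ?B y \<one>\<^bsub>?B\<^esub>"
  have le: "sh_le A x y" and "y \<noteq> \<one>"
    using xy by (simp_all add: level_part_def sh_less_iff)
  then have yi: "y \<in> carrier A" "level A y = i" using y by (auto simp: level_part_def)
  \<comment> \<open>This excludes that \<open>x\<close> is the added unit, so \<open>x\<close>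
    really has level \<open>i\<close>.\<close>
  have "x \<noteq> \<one>"
    using le \<open>y \<noteq> \<one>\<close> yi sh_le_antisym[of y \<one>] by auto
  then have xi: "x \<in> carrier A" "level A x = i" using x by (auto simp: level_part_def)
  obtain n :: nat where n: "y [^] n \<otimes> y [^] n = y [^] n" "sh_le A (y [^] n) y"
    using ex_idempotent_power[OF finite_carrier yi(1)] by blast
  \<comment> \<open>An idempotent below \<open>y\<close> is below every element of the level of
    \<open>y\<close>.\<close>
  then have "y [^] n \<in> idem_below A x"
    using yi xi idem_below_eq[of x y] by (simp add: idem_below_def)
  moreover have "y [^]\<^bsub>?B\<^esub> n = y [^] n" by (simp add: level_part_def nat_pow_def)
  ultimately have "sh_le ?B (y [^]\<^bsub>?B\<^esub> n) x"
    by (simp add: idem_below_def) (simp add: level_part_def)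
  then show "\<exists>n::nat. sh_le ?B (y [^]\<^bsub>?B\<^esub> n) x" ..
qed

section \<open>The isomorphism with the ordinal sum of the levels\<close>

lemma isomorphic_ordinal_sum_level_parts:
  "semihoop_isomorphic A (ordinal_sum (level A ` carrier A) (level_part A))"
proof -
  define F where "F = level_part A"
  \<comment> \<open>The candidate isomorphism tags each element other than \<open>1\<close> with its
    level and sends \<open>1\<close> to the common unit \<open>None\<close>.\<close>
  define h where "h x = osum_in F (level A x) x" for x
  have one_F [simp]: "\<one>\<^bsub>F i\<^esub> = \<one>" and mult_F [simp]: "monoid.mult (F i) = monoid.mult A"
    and imp_F [simp]: "imp (F i) = imp A" for i
    by (simp_all add: F_def level_part_def)
  have h_eq: "h x = (if x = \<one> then None else Some (level A x, x))" for x
    by (simp add: h_def osum_in_def)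
  have h_mult: "h (x \<otimes> y) = osum_mult F (h x) (h y)"
    if c: "x \<in> carrier A" "y \<in> carrier A" for x y
  proof (cases "x = \<one> \<or> y = \<one>")
    case True
    then show ?thesis using c by (auto simp: h_eq)
  next
    case False
    consider "level A x < level A y" | "level A y < level A x" | "level A x = level A y"
      by linarith
    then show ?thesis
    proof cases
      case 3
      then show ?thesis using False c level_mult[of x y] by (simp add: h_eq osum_in_def)
    qed (use False c mult_level_less[of x y] mult_level_less[of y x] in
          \<open>simp_all add: h_eq m_comm\<close>)
  qed
  have h_imp: "h (x \<leadsto> y) = osum_imp F (h x) (h y)"
    if c: "x \<in> carrier A" "y \<in> carrier A" for x y
  proof (cases "x = \<one> \<or> y = \<one>")
    case True
    then show ?thesis using c by (cases "x = \<one>") (auto simp: h_eq one_imp imp_one)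
  next
    case False
    consider "level A x < level A y" | "level A y < level A x" | "level A x = level A y"
      by linarith
    then show ?thesis
    proof cases
      case 1
      then show ?thesis using False c level_less_imp_le imp_eq_one_iff by (simp add: h_eq)
    next
      case 2
      then show ?thesis using False c imp_level_less by (simp add: h_eq)
    next
      \<comment> \<open>For \<open>x \<le> y\<close> both sides are \<open>None\<close>; otherwise
        \<open>level_imp\<close> shows that the residuum keeps the tag.\<close>
      case 3
      then show ?thesis
        using False c level_imp imp_eq_one_iff by (auto simp: h_eq osum_in_def)
    qed
  qed
  \<comment> \<open>The lattice operations of the sum are decided by whether a residuum is
    \<open>None\<close>, so this equivalence makes \<open>h\<close> preserve them.\<close>
  have le_iff: "osum_imp F (h x) (h y) = None \<longleftrightarrow> sh_le A x y"
    if "x \<in> carrier A" "y \<in> carrier A" for x y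
    using that by (simp flip: h_imp imp_eq_one_iff) (simp add: h_eq)
  have carrier_F: "carrier (F i) = insert \<one> {x \<in> carrier A. level A x = i}" for i
    by (simp add: F_def level_part_def)
  have "h ` carrier A = (\<Union>i\<in>level A ` carrier A. osum_in F i ` carrier (F i))"
    by (auto simp: h_eq osum_in_def carrier_F image_iff)
  moreover have "inj_on h (carrier A)" by (auto simp: inj_on_def h_eq split: if_splits)
  ultimately have bij: "bij_betw h (carrier A) (carrier (ordinal_sum (level A ` carrier A) F))"
    by (simp add: bij_betw_def ordinal_sum_def)
  have "h \<in> semihoop_iso A (ordinal_sum (level A ` carrier A) F)"
    unfolding semihoop_iso_def iso_def hom_def
    using bij bij_betw_apply[OF bij]
    by (auto simp: ordinal_sum_def h_mult h_imp le_iff wedge_eq_if vee_eq_if h_eq[of \<one>])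
  then show ?thesis
    unfolding semihoop_isomorphic_def F_def by blast
qed

end

theorem lemma2:
  fixes A :: "'a semihoop"
  assumes "mtl_chain A"
    and "finite (carrier A)"
    and "locally_unital A"
  shows "\<exists>(I :: nat set) (F :: nat \<Rightarrow> 'a semihoop).
    (\<forall>i \<in> I. mtl_chain (F i) \<and> archimedean (F i)) \<and>
    semihoop_isomorphic A (ordinal_sum I F)"
proof -
  interpret mtl_chain A by fact
  interpret finite_locally_unital_chain A
    using assms(2,3) by unfold_locales
  show ?thesis
    \<comment> \<open>The index set consists of the levels that occur in \<open>A\<close>, and
      \<open>F\<close> is \<open>level_part A\<close>.\<close>
    using mtl_chain_level_part archimedean_level_part isomorphic_ordinal_sum_level_parts by blast
qed

end
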